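(* Let $\sigma>0$. The function $$\Pi(y,\tau)=\frac{4y}{\sigma^2}\,e^{-\frac{1}{2y\tau}},\qquad y>0,\ \tau>0,$$ is a nontrivial solution of the degenerate parabolic equation $$\Pi_\tau=2y^{3}\,\Pi_{yy},\qquad y>0,\ \tau>0,$$ it vanishes at $\tau=0$ (that is, $\Pi(y,\tau)\to0$ as $\tau\to0^+$ for every $y>0$), and it grows linearly as $y\to+\infty$ (that is, for every $\tau>0$, $\Pi(y,\tau)/y$ tends to a finite nonzero limit as $y\to+\infty$).
   Context: The equation is the case $\alpha=\frac32$, $a=2$ of the family of equations with power-law degeneracy $\Pi_\tau=a\,y^{2\alpha}\Pi_{yy}$, $\alpha>0$, $a>0$. Nontrivial means not identically zero. *)

theory Defs
  imports "HOL-Analysis.Analysis"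
begin

definition quadrant :: "(real \<times> real) set" where
  "quadrant = {0<..} \<times> {0<..}"

(* u y \<tau> solves u_\<tau> = c(y) u_yy classically on y > 0, \<tau> > 0, i.e. u is C^2 in y and C^1 in \<tau>,
   with all the derivatives involved jointly continuous. The derivatives are two-sided because
   the domain is open. *)
definition classical_solution :: "(real \<Rightarrow> real) \<Rightarrow> (real \<Rightarrow> real \<Rightarrow> real) \<Rightarrow> bool" where
  "classical_solution c u \<longleftrightarrow>
    (\<exists>u_\<tau> u_y u_yy.
      (\<forall>y>0. \<forall>\<tau>>0.
        ((\<lambda>t. u y t) has_real_derivative u_\<tau> y \<tau>) (at \<tau>) \<and>
        ((\<lambda>x. u x \<tau>) has_real_derivative u_y y \<tau>) (at y) \<and>
        ((\<lambda>x. u_y x \<tau>) has_real_derivative u_yy y \<tau>) (at y) \<and>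
        u_\<tau> y \<tau> = c y * u_yy y \<tau>) \<and>
      continuous_on quadrant (\<lambda>(y, \<tau>). u y \<tau>) \<and>
      continuous_on quadrant (\<lambda>(y, \<tau>). u_\<tau> y \<tau>) \<and>
      continuous_on quadrant (\<lambda>(y, \<tau>). u_y y \<tau>) \<and>
      continuous_on quadrant (\<lambda>(y, \<tau>). u_yy y \<tau>))"

definition nontrivial :: "(real \<Rightarrow> real \<Rightarrow> real) \<Rightarrow> bool" where
  "nontrivial u \<longleftrightarrow> (\<exists>y>0. \<exists>\<tau>>0. u y \<tau> \<noteq> 0)"

definition vanishes_initially :: "(real \<Rightarrow> real \<Rightarrow> real) \<Rightarrow> bool" where
  "vanishes_initially u \<longleftrightarrow> (\<forall>y>0. ((\<lambda>\<tau>. u y \<tau>) \<longlongrightarrow> 0) (at_right 0))"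

definition grows_linearly :: "(real \<Rightarrow> real \<Rightarrow> real) \<Rightarrow> bool" where
  "grows_linearly u \<longleftrightarrow> (\<forall>\<tau>>0. \<exists>L. L \<noteq> 0 \<and> ((\<lambda>y. u y \<tau> / y) \<longlongrightarrow> L) at_top)"

(* Only the values at y > 0, \<tau> > 0 are meaningful. *)
definition Pi_sol :: "real \<Rightarrow> real \<Rightarrow> real \<Rightarrow> real" where
  "Pi_sol \<sigma> y \<tau> = 4 * y / \<sigma>\<^sup>2 * exp (- (1 / (2 * y * \<tau>)))"

end

theory Submission
  imports Defs "HOL-Real_Asymp.Real_Asymp"
begin

text \<open>Substituting \<Pi> = y v(x, \<tau>) with x = 1/y turns the equation into v_\<tau> = 2 x
  v_xx. The ansatz v = K exp(-x \<phi>(\<tau>)) solves this when \<phi>' = -2 \<phi>^2, and \<phi> =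
  1/(2 \<tau>), which blows up at \<tau> = 0, gives the stated function. The blow-up forces the zero
  initial values, while x = 0, that is y at infinity, leaves v = K and hence linear growth.
  \<open>Pi_sol_classical_solution\<close> checks the equation by direct differentiation; the other
  lemmas read off the behaviour of the exponential.\<close>

lemma Pi_sol_classical_solution:
  "classical_solution (\<lambda>y. 2 * y ^ 3) (Pi_sol \<sigma>)"
proof -
  define K where "K = 4 / \<sigma>\<^sup>2"
  \<comment> \<open>\<open>E\<close> is \<Pi>/y. Every derivative needed is \<open>E\<close> times a
    rational function, so the two derivatives of \<open>E\<close> and its joint continuity carry all
    the calculations.\<close>
  define E where "E = (\<lambda>y \<tau>. K * exp (- (1 / (2 * y * \<tau>))))"
  define u_\<tau> where "u_\<tau> = (\<lambda>y \<tau>. E y \<tau> / (2 * \<tau>\<^sup>2))"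
  define u_y where "u_y = (\<lambda>y \<tau>. E y \<tau> * (1 + 1 / (2 * y * \<tau>)))"
  \<comment> \<open>Differentiating \<open>u_y\<close> gives two terms E/(2 y^2 \<tau>) of opposite
    sign, one from \<open>E\<close> and one from the bracket; they cancel and leave only this
    one.\<close>
  define u_yy where "u_yy = (\<lambda>y \<tau>. E y \<tau> / (4 * y ^ 3 * \<tau>\<^sup>2))"
  have Pi_E: "Pi_sol \<sigma> = (\<lambda>y \<tau>. y * E y \<tau>)"
    by (simp add: Pi_sol_def E_def K_def fun_eq_iff)
  have E_\<tau>: "((\<lambda>t. E y t) has_real_derivative E y \<tau> / (2 * y * \<tau>\<^sup>2)) (at \<tau>)"
    if "y > 0" "\<tau> > 0" for y \<tau>
    unfolding E_def using that
    by (auto intro!: derivative_eq_intros simp: power2_eq_square ac_simps)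
  have E_y: "((\<lambda>x. E x \<tau>) has_real_derivative E y \<tau> / (2 * y\<^sup>2 * \<tau>)) (at y)"
    if "y > 0" "\<tau> > 0" for y \<tau>
    unfolding E_def using that
    by (auto intro!: derivative_eq_intros simp: power2_eq_square ac_simps)
  have E_cont: "continuous_on quadrant (\<lambda>p. E (fst p) (snd p))"
    unfolding E_def quadrant_def by (auto intro!: continuous_intros)
  have "((\<lambda>t. Pi_sol \<sigma> y t) has_real_derivative u_\<tau> y \<tau>) (at \<tau>)"
    if "y > 0" "\<tau> > 0" for y \<tau>
    unfolding Pi_E u_\<tau>_def using that
    by (auto intro!: derivative_eq_intros E_\<tau>)
  moreover have "((\<lambda>x. Pi_sol \<sigma> x \<tau>) has_real_derivative u_y y \<tau>) (at y)"
    if "y > 0" "\<tau> > 0" for y \<tau>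
    unfolding Pi_E u_y_def using that
    by (auto intro!: derivative_eq_intros E_y simp: field_simps power2_eq_square)
  moreover have "((\<lambda>x. u_y x \<tau>) has_real_derivative u_yy y \<tau>) (at y)"
    if "y > 0" "\<tau> > 0" for y \<tau>
    unfolding u_y_def u_yy_def using that
    by (auto intro!: derivative_eq_intros E_y
        simp: field_simps power2_eq_square power3_eq_cube)
  moreover have "u_\<tau> y \<tau> = 2 * y ^ 3 * u_yy y \<tau>" if "y > 0" "\<tau> > 0" for y \<tau>
    unfolding u_\<tau>_def u_yy_def using that by simp
  moreover have "continuous_on quadrant (\<lambda>(y, \<tau>). Pi_sol \<sigma> y \<tau>)"
    unfolding Pi_E case_prod_unfold by (intro continuous_intros E_cont)
  moreover have "continuous_on quadrant (\<lambda>(y, \<tau>). u_\<tau> y \<tau>)"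
    unfolding u_\<tau>_def case_prod_unfold
    by (intro continuous_intros E_cont) (auto simp: quadrant_def)
  moreover have "continuous_on quadrant (\<lambda>(y, \<tau>). u_y y \<tau>)"
    unfolding u_y_def case_prod_unfold
    by (intro continuous_intros E_cont) (auto simp: quadrant_def)
  moreover have "continuous_on quadrant (\<lambda>(y, \<tau>). u_yy y \<tau>)"
    unfolding u_yy_def case_prod_unfold
    by (intro continuous_intros E_cont) (auto simp: quadrant_def)
  ultimately show ?thesis
    unfolding classical_solution_def
    by (intro exI[of _ u_\<tau>] exI[of _ u_y] exI[of _ u_yy]) simp
qed

lemma Pi_sol_nontrivial: "\<sigma> \<noteq> 0 \<Longrightarrow> nontrivial (Pi_sol \<sigma>)"
  unfolding nontrivial_def Pi_sol_def by (rule exI[of _ 1], simp, rule exI[of _ 1], simp)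

text \<open>For fixed y > 0 the prefactor is constant in \<tau> and the exponent tends to minus
  infinity.\<close>

lemma Pi_sol_vanishes_initially: "vanishes_initially (Pi_sol \<sigma>)"
  unfolding vanishes_initially_def
proof (intro allI impI)
  fix y :: real
  assume "y > 0"
  then have "((\<lambda>\<tau>. exp (- (1 / (2 * y * \<tau>)))) \<longlongrightarrow> 0) (at_right 0)"
    by real_asymp
  then show "((\<lambda>\<tau>. Pi_sol \<sigma> y \<tau>) \<longlongrightarrow> 0) (at_right 0)"
    unfolding Pi_sol_def by (rule tendsto_mult_right_zero)
qed

text \<open>Division by y removes the linear factor, and the exponent tends to 0 for fixed \<tau>,
  so the limit is 4/\<sigma>^2.\<close>

lemma Pi_sol_grows_linearly:
  assumes "\<sigma> \<noteq> 0"
  shows "grows_linearly (Pi_sol \<sigma>)"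
  unfolding grows_linearly_def
proof (intro allI impI exI conjI)
  fix \<tau> :: real
  assume "\<tau> > 0"
  then have "((\<lambda>y. exp (- (1 / (2 * y * \<tau>)))) \<longlongrightarrow> 1) at_top"
    by real_asymp
  then have "((\<lambda>y. 4 / \<sigma>\<^sup>2 * exp (- (1 / (2 * y * \<tau>)))) \<longlongrightarrow> 4 / \<sigma>\<^sup>2 * 1) at_top"
    by (rule tendsto_mult_left)
  \<comment> \<open>The two sides differ at y = 0, where division by zero yields 0, so y is taken
    positive before cancelling.\<close>
  moreover have "eventually (\<lambda>y. 4 / \<sigma>\<^sup>2 * exp (- (1 / (2 * y * \<tau>))) = Pi_sol \<sigma> y \<tau> / y) at_top"
    using eventually_gt_at_top[of 0] by eventually_elim (simp add: Pi_sol_def)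
  \<comment> \<open>This instantiates the witness that \<open>exI\<close> left open, so it precedes
    the proof that the limit is nonzero.\<close>
  ultimately show "((\<lambda>y. Pi_sol \<sigma> y \<tau> / y) \<longlongrightarrow> 4 / \<sigma>\<^sup>2 * 1) at_top"
    by (rule Lim_transform_eventually)
  show "4 / \<sigma>\<^sup>2 * 1 \<noteq> 0"
    using assms by simp
qed

theorem mainTheorem2:
  fixes \<sigma> :: real
  assumes "\<sigma> > 0"
  shows "classical_solution (\<lambda>y. 2 * y ^ 3) (Pi_sol \<sigma>)
       \<and> nontrivial (Pi_sol \<sigma>)
       \<and> vanishes_initially (Pi_sol \<sigma>)
       \<and> grows_linearly (Pi_sol \<sigma>)"
  using assms Pi_sol_classical_solution Pi_sol_nontrivial Pi_sol_vanishes_initially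
    Pi_sol_grows_linearly by simp

end
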